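(* For any fixed $0<\beta\le9$, the matrix $\gamma_{\beta,e}(2\pi)$ is hyperbolic when $e\in(-1,1)$ and $1-|e|$ is small enough.
   Context: Let $J=\begin{pmatrix}0&-I_2\\ I_2&0\end{pmatrix}$ and $\mathrm{Sp}(4)=\{M\in \mathrm{GL}(4,\mathbb R): M^TJM=J\}$. For $(\beta,e)\in[0,9]\times(-1,1)$ let $\gamma_{\beta,e}:[0,2\pi]\to\mathrm{Sp}(4)$ be the solution of $\dot\gamma(t)=JB(t)\gamma(t)$, $\gamma(0)=I_4$, where $$B(t)=\begin{pmatrix}1&0&0&1\\0&1&-1&0\\0&-1&\frac{2e\cos t-1-\sqrt{9-\beta}}{2(1+e\cos t)}&0\\1&0&0&\frac{2e\cos t-1+\sqrt{9-\beta}}{2(1+e\cos t)}\end{pmatrix}.$$ (For $e\ge0$ it is the essential part of the fundamental solution of the linearized system along the elliptic Lagrangian solution of the planar three-body problem with eccentricity $e$ and mass parameter $\beta$; it is extended to $e<0$ by the same formula.) A symplectic matrix is hyperbolic if it has no eigenvalue on the unit circle of $\mathbb C$. *)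

theory Defs
  imports "HOL-Analysis.Analysis"
begin

lemma vector_4 [simp]:
  "(vector [a, b, c, d] :: 'a::zero^4) $ 1 = a"
  "(vector [a, b, c, d] :: 'a::zero^4) $ 2 = b"
  "(vector [a, b, c, d] :: 'a::zero^4) $ 3 = c"
  "(vector [a, b, c, d] :: 'a::zero^4) $ 4 = d"
  unfolding vector_def by simp_all

definition J4 :: "real^4^4" where
  "J4 = vector [vector [0, 0, -1,  0],
                vector [0, 0,  0, -1],
                vector [1, 0,  0,  0],
                vector [0, 1,  0,  0]]"

definition Sp4 :: "(real^4^4) set" where
  "Sp4 = {M. invertible M \<and> transpose M ** J4 ** M = J4}"

definition B :: "real \<Rightarrow> real \<Rightarrow> real \<Rightarrow> real^4^4" where
  "B \<beta> e t =
     vector [vector [1,  0,  0, 1],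
             vector [0,  1, -1, 0],
             vector [0, -1, (2 * e * cos t - 1 - sqrt (9 - \<beta>)) / (2 * (1 + e * cos t)), 0],
             vector [1,  0,  0, (2 * e * cos t - 1 + sqrt (9 - \<beta>)) / (2 * (1 + e * cos t))]]"

(* Only the restriction of \<gamma> to [0, 2 pi] matters; the derivative is one-sided at the end points.
   For -1 < e < 1 the coefficient B is continuous in t, so by the linear existence and uniqueness
   theorem exactly one such function on [0, 2 pi] exists. *)
definition is_gamma :: "real \<Rightarrow> real \<Rightarrow> (real \<Rightarrow> real^4^4) \<Rightarrow> bool" where
  "is_gamma \<beta> e \<gamma> \<longleftrightarrow>
     \<gamma> 0 = mat 1 \<and>
     (\<forall>t\<in>{0..2*pi}. (\<gamma> has_vector_derivative (J4 ** B \<beta> e t ** \<gamma> t)) (at t within {0..2*pi}))"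

definition complex_eigenvalue :: "real^'n^'n \<Rightarrow> complex \<Rightarrow> bool" where
  "complex_eigenvalue M z \<longleftrightarrow>
     (\<exists>v :: complex^'n. v \<noteq> 0 \<and> map_matrix complex_of_real M *v v = z *s v)"

(* The term is used for symplectic matrices only, so membership in Sp(4) is part of the predicate. *)
definition hyperbolic :: "real^4^4 \<Rightarrow> bool" where
  "hyperbolic M \<longleftrightarrow> M \<in> Sp4 \<and> (\<forall>z. complex_eigenvalue M z \<longrightarrow> cmod z \<noteq> 1)"

end

theory Submission
  imports Defs
begin

text \<open>
  Write a solution as \<open>z = (p, q)\<close>. For a symmetric \<open>2\<pi>\<close>-periodic \<open>W\<close> the form
  \<open>\<langle>p, q\<rangle> - \<langle>W q, q\<rangle>\<close> has along the flow the derivative \<open>\<bar>p - W q\<bar>\<^sup>2 + \<langle>N q, q\<rangle>\<close>, where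
  \<open>N = - (W' + W\<^sup>2 + D + W K - K W)\<close>, \<open>D\<close> is the lower right block of \<open>B\<close> and \<open>K = (0, 1; -1, 0)\<close>.
  If \<open>N\<close> is positive definite, the form increases strictly, whereas on a complex solution with
  a unimodular multiplier it would take equal values at \<open>0\<close> and \<open>2\<pi>\<close>.

  For \<open>e = 1\<close>, with \<open>s = sqrt (9 - \<beta>)\<close> and \<open>T = sin t / (1 + cos t)\<close>, the choice
  \<open>W = - ((1 + s/6) T, s/6; s/6, (1 - s/6) T)\<close> gives exactly \<open>N = \<beta> / (18 (1 + cos t)) I\<close>. It
  interpolates linearly between \<open>- T I\<close> for \<open>s = 0\<close> and, for \<open>s = 3\<close>, the Riccati solution of
  the Lagrangian plane spanned by the explicit parabolic Kepler variations
  \<open>q = (1 + cos t) (sin t, 1 + cos t)\<close> and \<open>q = ((1 + cos t) cos t, - (2 + cos t) sin t)\<close>.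
  This \<open>W\<close> is singular at \<open>t = \<pi>\<close>, where \<open>- D\<close> itself is large and positive of order
  \<open>(t - \<pi>)\<^sup>-\<^sup>2\<close>. Multiplying \<open>W\<close> by a cutoff that varies slowly in
  \<open>ln (1 + cos t)\<close> costs only a small multiple of \<open>(t - \<pi>)\<^sup>-\<^sup>2\<close>, and the result survives the
  perturbation from \<open>e = 1\<close> to \<open>e < 1\<close>.
\<close>

section \<open>The flow in coordinates and its symplecticity\<close>

lemma is_gamma_components:
  fixes x :: "real^4"
  assumes "is_gamma b e \<gamma>" "t \<in> {0..2*pi}"
  defines "z \<equiv> \<lambda>t. \<gamma> t *v x"
  shows "((\<lambda>t. z t $ 1) has_real_derivative z t $ 2 - B b e t $ 3 $ 3 * z t $ 3) (at t within {0..2*pi})"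
    and "((\<lambda>t. z t $ 2) has_real_derivative - z t $ 1 - B b e t $ 4 $ 4 * z t $ 4) (at t within {0..2*pi})"
    and "((\<lambda>t. z t $ 3) has_real_derivative z t $ 1 + z t $ 4) (at t within {0..2*pi})"
    and "((\<lambda>t. z t $ 4) has_real_derivative z t $ 2 - z t $ 3) (at t within {0..2*pi})"
proof -
  have bl: "bounded_linear (\<lambda>M :: real^4^4. (M *v x) $ i)" for i
    unfolding matrix_vector_mult_def
    by (auto intro!: bounded_linear_intros bounded_linear_compose[OF bounded_linear_vec_nth])
  have "((\<lambda>t. z t $ i) has_vector_derivative (J4 ** B b e t ** \<gamma> t *v x) $ i) (at t within {0..2*pi})" for i
    unfolding z_def
    using assms(1,2) by (auto simp: is_gamma_def intro!: bounded_linear.has_vector_derivative[OF bl])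
  then have *: "((\<lambda>t. z t $ i) has_real_derivative (J4 *v (B b e t *v z t)) $ i) (at t within {0..2*pi})" for i
    by (simp add: has_real_derivative_iff_has_vector_derivative z_def matrix_vector_mul_assoc matrix_mul_assoc)
  show "((\<lambda>t. z t $ 1) has_real_derivative z t $ 2 - B b e t $ 3 $ 3 * z t $ 3) (at t within {0..2*pi})"
    and "((\<lambda>t. z t $ 2) has_real_derivative - z t $ 1 - B b e t $ 4 $ 4 * z t $ 4) (at t within {0..2*pi})"
    and "((\<lambda>t. z t $ 3) has_real_derivative z t $ 1 + z t $ 4) (at t within {0..2*pi})"
    and "((\<lambda>t. z t $ 4) has_real_derivative z t $ 2 - z t $ 3) (at t within {0..2*pi})"
    using *[of 1] *[of 2] *[of 3] *[of 4]
    by (simp_all add: matrix_vector_mult_def sum_4 J4_def B_def)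
qed

lemma inner_J4: "x \<bullet> (J4 *v y) = - x $ 1 * y $ 3 - x $ 2 * y $ 4 + x $ 3 * y $ 1 + x $ 4 * y $ 2"
  by (simp add: inner_vec_def matrix_vector_mult_def sum_4 J4_def)

text \<open>The symplectic form of any two solutions is constant in time. Apart from
  \<open>Sp4\<close> itself, the invertibility matters later: it carries a zero of a solution at
  time \<open>t\<close> back to its initial vector.\<close>

lemma is_gamma_Sp4:
  assumes "is_gamma b e \<gamma>" "t \<in> {0..2*pi}"
  shows "\<gamma> t \<in> Sp4"
proof -
  have form: "(\<gamma> t *v x) \<bullet> (J4 *v (\<gamma> t *v y)) = x \<bullet> (J4 *v y)" for x y
  proof -
    have "((\<lambda>t. (\<gamma> t *v x) \<bullet> (J4 *v (\<gamma> t *v y))) has_real_derivative 0) (at t within {0..2*pi})"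
      if "t \<in> {0..2*pi}" for t
      unfolding inner_J4
      by (rule derivative_eq_intros is_gamma_components[OF assms(1) that] refl)+ algebra
    then have "\<exists>c. \<forall>t\<in>{0..2*pi}. (\<gamma> t *v x) \<bullet> (J4 *v (\<gamma> t *v y)) = c"
      by (intro has_field_derivative_zero_constant) auto
    then have "(\<gamma> t *v x) \<bullet> (J4 *v (\<gamma> t *v y)) = (\<gamma> 0 *v x) \<bullet> (J4 *v (\<gamma> 0 *v y))"
      using assms(2) by force
    then show ?thesis
      using assms(1) by (simp add: is_gamma_def)
  qed
  have "x \<bullet> (transpose (\<gamma> t) ** J4 ** \<gamma> t *v y) = (\<gamma> t *v x) \<bullet> (J4 *v (\<gamma> t *v y))" for x y
    by (simp only: matrix_vector_mul_assoc[symmetric] dot_lmul_matrix[symmetric] vector_transpose_matrix)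
  then have "transpose (\<gamma> t) ** J4 ** \<gamma> t *v y = J4 *v y" for y
    by (intro vector_eq_ldot[THEN iffD1]) (simp only: form simp_thms)
  then have J: "transpose (\<gamma> t) ** J4 ** \<gamma> t = J4"
    unfolding matrix_eq by blast
  \<comment> \<open>The preserved form is nondegenerate, so the kernel is trivial.\<close>
  have "y = 0" if "\<gamma> t *v y = 0" for y
  proof -
    have "x \<bullet> (J4 *v y) = 0" for x
      using form[of x y] that by simp
    from this[of "J4 *v y"] have "J4 *v y = 0" by simp
    then show "y = 0"
      by (simp add: vec_eq_iff forall_4 matrix_vector_mult_def sum_4 J4_def)
  qed
  then have "invertible (\<gamma> t)"
    by (simp add: invertible_left_inverse matrix_left_invertible_ker)
  with J show ?thesis by (simp add: Sp4_def)
qed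

section \<open>A Riccati criterion for hyperbolicity\<close>

lemma hyperbolic_if_riccati:
  fixes w11 w12 w22 w11' w12' w22' :: "real \<Rightarrow> real"
  assumes \<gamma>: "is_gamma b e \<gamma>"
    and deriv: "\<And>t. (w11 has_real_derivative w11' t) (at t)"
      "\<And>t. (w12 has_real_derivative w12' t) (at t)"
      "\<And>t. (w22 has_real_derivative w22' t) (at t)"
    and periodic: "w11 (2*pi) = w11 0" "w12 (2*pi) = w12 0" "w22 (2*pi) = w22 0"
    and pos: "\<And>t q1 q2. q1 \<noteq> 0 \<or> q2 \<noteq> 0 \<Longrightarrow>
        - (w11' t + (w11 t)\<^sup>2 + (w12 t)\<^sup>2 + B b e t $ 3 $ 3 - 2 * w12 t) * q1\<^sup>2
        - 2 * (w12' t + w12 t * (w11 t + w22 t) + w11 t - w22 t) * q1 * q2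
        - (w22' t + (w12 t)\<^sup>2 + (w22 t)\<^sup>2 + B b e t $ 4 $ 4 + 2 * w12 t) * q2\<^sup>2 > 0"
  shows "hyperbolic (\<gamma> (2 * pi))"
proof -
  define N where "N = (\<lambda>t q1 q2.
        - (w11' t + (w11 t)\<^sup>2 + (w12 t)\<^sup>2 + B b e t $ 3 $ 3 - 2 * w12 t) * q1\<^sup>2
        - 2 * (w12' t + w12 t * (w11 t + w22 t) + w11 t - w22 t) * q1 * q2
        - (w22' t + (w12 t)\<^sup>2 + (w22 t)\<^sup>2 + B b e t $ 4 $ 4 + 2 * w12 t) * q2\<^sup>2)"
  \<comment> \<open>Here p is formed by components 1, 2 and q by components 3, 4. \<open>D\<close>
    is the derivative of \<open>Q\<close> along solutions and vanishes only at the zero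
    vector.\<close>
  define Q where "Q = (\<lambda>t (z :: real^4). z $ 1 * z $ 3 + z $ 2 * z $ 4
        - (w11 t * (z $ 3)\<^sup>2 + 2 * w12 t * z $ 3 * z $ 4 + w22 t * (z $ 4)\<^sup>2))"
  define D where "D = (\<lambda>t (z :: real^4). (z $ 1 - w11 t * z $ 3 - w12 t * z $ 4)\<^sup>2
        + (z $ 2 - w12 t * z $ 3 - w22 t * z $ 4)\<^sup>2 + N t (z $ 3) (z $ 4))"
  have N: "N t q1 q2 \<ge> 0" "N t q1 q2 = 0 \<Longrightarrow> q1 = 0 \<and> q2 = 0" for t q1 q2
    using pos[of q1 q2 t] unfolding N_def by (cases "q1 = 0 \<and> q2 = 0"; force)+
  have D_nonneg: "D t z \<ge> 0" for t z
    unfolding D_def using N by simp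
  have D_0: "z = 0" if "D t z = 0" for t z
  proof -
    have "N t (z $ 3) (z $ 4) = 0" and sq: "(z $ 1 - w11 t * z $ 3 - w12 t * z $ 4)\<^sup>2 = 0"
      "(z $ 2 - w12 t * z $ 3 - w22 t * z $ 4)\<^sup>2 = 0"
      using that N(1)[of t "z $ 3" "z $ 4"] unfolding D_def
      by (smt (verit) zero_le_power2)+
    then have "z $ 3 = 0" "z $ 4 = 0" using N(2) by blast+
    then show "z = 0"
      using sq by (simp add: vec_eq_iff forall_4)
  qed
  have deriv': "(w11 has_real_derivative w11' t) (at t within S)"
      "(w12 has_real_derivative w12' t) (at t within S)"
      "(w22 has_real_derivative w22' t) (at t within S)" for t S
    using deriv by (auto intro: has_field_derivative_at_within)
  have Q_deriv: "((\<lambda>t. Q t (\<gamma> t *v x)) has_real_derivative D t (\<gamma> t *v x)) (at t within {0..2*pi})"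
    if "t \<in> {0..2*pi}" for t x
    unfolding Q_def D_def N_def
    by (rule derivative_eq_intros deriv' is_gamma_components[OF \<gamma> that] refl)+
       (simp add: power2_eq_square algebra_simps)
  have "cmod \<zeta> \<noteq> 1" if ev: "complex_eigenvalue (\<gamma> (2*pi)) \<zeta>" for \<zeta>
  proof
    assume unit: "cmod \<zeta> = 1"
    define M where "M = \<gamma> (2*pi)"
    from ev obtain v :: "complex^4" where v: "v \<noteq> 0" "map_matrix complex_of_real M *v v = \<zeta> *s v"
      by (auto simp: complex_eigenvalue_def M_def)
    define x y :: "real^4" where "x = (\<chi> i. Re (v $ i))" and "y = (\<chi> i. Im (v $ i))"
    have eq: "(\<Sum>j\<in>UNIV. complex_of_real (M $ i $ j) * v $ j) = \<zeta> * v $ i" for i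
      using arg_cong[OF v(2), of "\<lambda>u. u $ i"] by (simp add: matrix_vector_mult_def map_matrix_def)
    have Mx: "M *v x = Re \<zeta> *\<^sub>R x - Im \<zeta> *\<^sub>R y"
      unfolding vec_eq_iff
    proof
      fix i show "(M *v x) $ i = (Re \<zeta> *\<^sub>R x - Im \<zeta> *\<^sub>R y) $ i"
        using arg_cong[OF eq[of i], of Re] by (simp add: matrix_vector_mult_def x_def y_def)
    qed
    have My: "M *v y = Re \<zeta> *\<^sub>R y + Im \<zeta> *\<^sub>R x"
      unfolding vec_eq_iff
    proof
      fix i show "(M *v y) $ i = (Re \<zeta> *\<^sub>R y + Im \<zeta> *\<^sub>R x) $ i"
        using arg_cong[OF eq[of i], of Im] by (simp add: matrix_vector_mult_def x_def y_def)
    qed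
    \<comment> \<open>\<open>E\<close> is the Hermitian extension of \<open>Q\<close> at the complex
      solution starting at x + i y. At the end time the cross terms cancel, so the multiplier enters
      only through its squared modulus.\<close>
    define E where "E = (\<lambda>t. Q t (\<gamma> t *v x) + Q t (\<gamma> t *v y))"
    have "E (2*pi) = ((Re \<zeta>)\<^sup>2 + (Im \<zeta>)\<^sup>2) * (Q 0 x + Q 0 y)"
      unfolding E_def M_def[symmetric] Mx My Q_def periodic
      by (simp add: power2_eq_square algebra_simps)
    also have "\<dots> = E 0"
      using unit cmod_power2[of \<zeta>] \<gamma> by (simp add: E_def is_gamma_def)
    finally have "E (2*pi) = E 0" .
    moreover have "(E has_real_derivative D t (\<gamma> t *v x) + D t (\<gamma> t *v y)) (at t within {0..2*pi})"
      if "t \<in> {0..2*pi}" for t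
      unfolding E_def by (intro DERIV_add Q_deriv that)
    \<comment> \<open>Since the end values agree, the mean value theorem gives a time at which the
      nonnegative derivative of \<open>E\<close> vanishes.\<close>
    then have "\<exists>t\<in>{0..2*pi}. E (2*pi) - E 0 = (D t (\<gamma> t *v x) + D t (\<gamma> t *v y)) * (2*pi - 0)"
      by (intro mvt_very_simple) (auto simp: has_field_derivative_def)
    ultimately obtain t where t: "t \<in> {0..2*pi}" "D t (\<gamma> t *v x) + D t (\<gamma> t *v y) = 0"
      by auto
    then have "\<gamma> t *v x = 0" "\<gamma> t *v y = 0"
      using D_nonneg D_0 by (metis add_nonneg_eq_0_iff)+
    moreover have "invertible (\<gamma> t)"
      using is_gamma_Sp4[OF \<gamma> t(1)] by (simp add: Sp4_def)
    ultimately have "x = 0" "y = 0"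
      by (metis invertible_left_inverse matrix_left_invertible_ker)+
    then have "v = 0"
      by (simp add: x_def y_def vec_eq_iff complex_eq_iff)
    with v(1) show False ..
  qed
  then show ?thesis
    using is_gamma_Sp4[OF \<gamma>, of "2*pi"] by (simp add: hyperbolic_def)
qed

section \<open>A cutoff on the logarithmic scale\<close>

text \<open>With \<theta> = k ln (2/r), which runs from 0 at r = 2 to 1 at the inner end, the cutoff
  is x = (1 - \<theta>^2)^2. The outer square gives a double zero at the inner end, hence a
  differentiable gluing. The inner square keeps the squared derivative below a multiple of (k/r)^2 x
  (1 - x) for r up to 2, which lets it be absorbed later.\<close>

definition log_cutoff :: "real \<Rightarrow> real \<Rightarrow> real" where
  "log_cutoff k r = (if r \<le> 2 * exp (- 1 / k) then 0 else (1 - (k * ln (2 / r))\<^sup>2)\<^sup>2)"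

definition log_cutoff' :: "real \<Rightarrow> real \<Rightarrow> real" where
  "log_cutoff' k r = (if r \<le> 2 * exp (- 1 / k) then 0
     else 4 * k * (k * ln (2 / r)) * (1 - (k * ln (2 / r))\<^sup>2) / r)"

lemma log_cutoff_has_derivative:
  assumes "k > 0"
  shows "(log_cutoff k has_real_derivative log_cutoff' k r) (at r)"
proof -
  define a where "a = 2 * exp (- 1 / k)"
  define g where "g = (\<lambda>r. (1 - (k * ln (2 / r))\<^sup>2)\<^sup>2)"
  have a: "a > 0" by (simp add: a_def)
  have ga: "k * ln (2 / a) = 1"
    using assms by (simp add: a_def exp_minus ln_div ln_inverse field_simps)
  have f: "log_cutoff k = (\<lambda>r. if r \<le> a then 0 else g r)"
    by (auto simp: log_cutoff_def a_def g_def fun_eq_iff)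
  have dg: "(g has_real_derivative 4 * k * (k * ln (2 / r)) * (1 - (k * ln (2 / r))\<^sup>2) / r) (at r)"
    if "r > 0" for r
    unfolding g_def
    using that by (auto intro!: derivative_eq_intros simp: field_simps power2_eq_square)
  consider "r < a" | "r > a" | "r = a" by linarith
  then show ?thesis
  proof cases
    case 1
    have "((\<lambda>_. 0) has_real_derivative 0) (at r)" by simp
    moreover have "\<forall>\<^sub>F x in nhds r. log_cutoff k x = 0"
      using eventually_nhds_in_open[of "{..<a}" r] 1 by (auto simp: f elim!: eventually_mono)
    ultimately show ?thesis
      using 1 DERIV_cong_ev[of r r "log_cutoff k" "\<lambda>_. 0" 0 0]
      by (simp add: log_cutoff'_def a_def)
  next
    case 2
    have "\<forall>\<^sub>F x in nhds r. log_cutoff k x = g x"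
      using eventually_nhds_in_open[of "{a<..}" r] 2 by (auto simp: f elim!: eventually_mono)
    then show ?thesis
      using 2 order.strict_trans[OF a 2] dg[of r] DERIV_cong_ev[of r r "log_cutoff k" g]
      by (simp add: log_cutoff'_def a_def)
  next
    case 3
    have g0: "g a = 0" by (simp only: g_def ga) simp
    \<comment> \<open>The factor 1 - \<theta>^2 vanishes at \<open>a\<close>, so \<open>g\<close> is
      flat there; the cutoff is dominated by \<open>g\<close> in absolute value and inherits
      this.\<close>
    have "(g has_real_derivative 0) (at a)"
      using dg[OF a] by (simp only: ga) simp
    then have "((\<lambda>x. g x / (x - a)) \<longlongrightarrow> 0) (at a)"
      by (simp add: has_field_derivative_iff g0)
    then have "((\<lambda>x. \<bar>g x / (x - a)\<bar>) \<longlongrightarrow> 0) (at a)"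
      by (rule tendsto_rabs_zero)
    then have "((\<lambda>x. log_cutoff k x / (x - a)) \<longlongrightarrow> 0) (at a)"
      by (rule Lim_null_comparison[rotated]) (simp add: f)
    then show ?thesis
      using 3 by (simp add: has_field_derivative_iff f log_cutoff'_def a_def)
  qed
qed

text \<open>The factor 1/r carries the pole of sin t / (1 + cos t). The cutoff vanishes in a
  neighbourhood of r = 0, so the quotient is differentiable even there.\<close>

lemma log_cutoff_divide_has_derivative:
  assumes "k > 0"
  shows "((\<lambda>r. log_cutoff k r / r) has_real_derivative
           (log_cutoff' k r * r - log_cutoff k r) / r\<^sup>2) (at r)"
proof (cases "r < 2 * exp (- 1 / k)")
  case True
  have "((\<lambda>_. 0) has_real_derivative 0) (at r)" by simp
  moreover have "\<forall>\<^sub>F x in nhds r. log_cutoff k x / x = 0"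
    using eventually_nhds_in_open[of "{..<2 * exp (- 1 / k)}" r] True
    by (auto simp: log_cutoff_def elim!: eventually_mono)
  ultimately show ?thesis
    using True DERIV_cong_ev[of r r "\<lambda>r. log_cutoff k r / r" "\<lambda>_. 0" 0 0]
    by (simp add: log_cutoff'_def log_cutoff_def)
next
  case False
  then have "r > 0" by (smt (verit) exp_gt_zero)
  then show ?thesis
    by (auto intro!: derivative_eq_intros log_cutoff_has_derivative[OF assms] simp: power2_eq_square)
qed

section \<open>Positivity of the cut-off Riccati form\<close>

text \<open>
  Here \<open>u = 1 / (1 + cos t)\<close>, \<open>v = 1 / (1 + e cos t)\<close>, and \<open>x\<close> is the cutoff with derivative \<open>dx\<close>;
  the left-hand side is \<open>\<langle>N q, q\<rangle>\<close> for \<open>x W\<close>.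
\<close>

lemma riccati_identity:
  fixes b s T u v x dx q1 q2 :: real
  assumes "s\<^sup>2 = 9 - b" "2 * u = 1 + T\<^sup>2"
  defines "w11 \<equiv> - (1 + s / 6) * (x * T)" and "w12 \<equiv> - (s / 6) * x" and "w22 \<equiv> - (1 - s / 6) * (x * T)"
      and "V1 \<equiv> - (1 + s / 6) * T * q1 - s / 6 * q2" and "V2 \<equiv> - (s / 6) * q1 - (1 - s / 6) * T * q2"
  shows "- (- (1 + s / 6) * (dx * T + x * u) + w11\<^sup>2 + w12\<^sup>2 + (1 - (3 + s) / 2 * v) - 2 * w12) * q1\<^sup>2
       - 2 * (- (s / 6) * dx + w12 * (w11 + w22) + w11 - w22) * q1 * q2
       - (- (1 - s / 6) * (dx * T + x * u) + w12\<^sup>2 + w22\<^sup>2 + (1 - (3 - s) / 2 * v) + 2 * w12) * q2\<^sup>2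
     = x * (b / 18 * u * (q1\<^sup>2 + q2\<^sup>2) - (u - v) * ((3 + s) / 2 * q1\<^sup>2 + (3 - s) / 2 * q2\<^sup>2))
       + (1 - x) * (((3 + s) / 2 * v - 1) * q1\<^sup>2 + ((3 - s) / 2 * v - 1) * q2\<^sup>2)
       + x * (1 - x) * (V1\<^sup>2 + V2\<^sup>2) - dx * (V1 * q1 + V2 * q2)"
proof -
  have b: "b = 9 - s\<^sup>2" and u: "u = (1 + T\<^sup>2) / 2" using assms(1,2) by auto
  show ?thesis unfolding w11_def w12_def w22_def V1_def V2_def b u
    by (simp add: field_simps power2_eq_square) 
qed

text \<open>Completing squares absorbs the term with the derivative of the cutoff into x (1 - x)
  |V|^2, where x = y^2, at the price 4 d^2 |q|^2. Everything else is bounded below by its worst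
  multiple of |q|^2.\<close>

lemma cutoff_form_pos:
  fixes b s \<theta> d T u v q1 q2 :: real
  assumes s: "0 \<le> s" "s < 3" and v: "v > 0" and \<theta>: "\<theta>\<^sup>2 \<le> 1"
    and q: "q1 \<noteq> 0 \<or> q2 \<noteq> 0"
  defines "y \<equiv> 1 - \<theta>\<^sup>2"
  assumes pos: "y\<^sup>2 * (b / 18 * u - 3 * max 0 (u - v)) + (1 - y\<^sup>2) * ((3 - s) / 2 * v - 1) - 4 * d\<^sup>2 > 0"
  shows "y\<^sup>2 * (b / 18 * u * (q1\<^sup>2 + q2\<^sup>2) - (u - v) * ((3 + s) / 2 * q1\<^sup>2 + (3 - s) / 2 * q2\<^sup>2))
       + (1 - y\<^sup>2) * (((3 + s) / 2 * v - 1) * q1\<^sup>2 + ((3 - s) / 2 * v - 1) * q2\<^sup>2)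
       + y\<^sup>2 * (1 - y\<^sup>2) * (V1\<^sup>2 + V2\<^sup>2) - (- 4 * y * \<theta> * d) * (V1 * q1 + V2 * q2) > 0"
proof -
  define n where "n = q1\<^sup>2 + q2\<^sup>2"
  have n: "n > 0"
    using q by (simp add: n_def sum_power2_gt_zero_iff)
  have y: "0 \<le> y" "y \<le> 1" using \<theta> by (auto simp: y_def)
  have y2: "y\<^sup>2 \<le> 1" using y by (simp add: power_le_one)
  \<comment> \<open>The sign of u - v is not known; only its positive part hurts, and (3 + s)/2, (3
    - s)/2 are at most 3.\<close>
  have "(u - v) * ((3 + s) / 2 * q1\<^sup>2 + (3 - s) / 2 * q2\<^sup>2)
      \<le> max 0 (u - v) * ((3 + s) / 2 * q1\<^sup>2 + (3 - s) / 2 * q2\<^sup>2)"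
    using s by (intro mult_right_mono) auto
  also have "\<dots> \<le> max 0 (u - v) * (3 * q1\<^sup>2 + 3 * q2\<^sup>2)"
    using s by (intro mult_left_mono add_mono mult_right_mono) auto
  finally have 1: "y\<^sup>2 * ((b / 18 * u - 3 * max 0 (u - v)) * n) \<le>
      y\<^sup>2 * (b / 18 * u * (q1\<^sup>2 + q2\<^sup>2) - (u - v) * ((3 + s) / 2 * q1\<^sup>2 + (3 - s) / 2 * q2\<^sup>2))"
    by (intro mult_left_mono) (auto simp: n_def algebra_simps)
  have "((3 - s) / 2 * v - 1) * q1\<^sup>2 \<le> ((3 + s) / 2 * v - 1) * q1\<^sup>2"
    using s v by (intro mult_right_mono) (auto simp: field_simps)
  then have 2: "(1 - y\<^sup>2) * (((3 - s) / 2 * v - 1) * n) \<le>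
      (1 - y\<^sup>2) * (((3 + s) / 2 * v - 1) * q1\<^sup>2 + ((3 - s) / 2 * v - 1) * q2\<^sup>2)"
    using y2 by (intro mult_left_mono) (auto simp: n_def distrib_left)
  \<comment> \<open>This is 1 - y^2 = (1 - y)(1 + y) with 1 - y = \<theta>^2.\<close>
  have "1 - y\<^sup>2 - \<theta>\<^sup>2 = y * \<theta>\<^sup>2"
    by (simp add: y_def power2_eq_square algebra_simps)
  then have "\<theta>\<^sup>2 \<le> 1 - y\<^sup>2"
    using y by (smt (verit) mult_nonneg_nonneg zero_le_power2)
  then have "y\<^sup>2 * \<theta>\<^sup>2 * (V1\<^sup>2 + V2\<^sup>2) \<le> y\<^sup>2 * (1 - y\<^sup>2) * (V1\<^sup>2 + V2\<^sup>2)"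
    by (intro mult_right_mono mult_left_mono) auto
  moreover have "y\<^sup>2 * \<theta>\<^sup>2 * (V1\<^sup>2 + V2\<^sup>2) - (- 4 * y * \<theta> * d) * (V1 * q1 + V2 * q2) =
      (y * \<theta> * V1 + 2 * d * q1)\<^sup>2 + (y * \<theta> * V2 + 2 * d * q2)\<^sup>2 - 4 * d\<^sup>2 * n"
    by (simp add: n_def power2_eq_square algebra_simps)
  ultimately have 3: "- 4 * d\<^sup>2 * n \<le>
      y\<^sup>2 * (1 - y\<^sup>2) * (V1\<^sup>2 + V2\<^sup>2) - (- 4 * y * \<theta> * d) * (V1 * q1 + V2 * q2)"
    using zero_le_power2[of "y * \<theta> * V1 + 2 * d * q1"] zero_le_power2[of "y * \<theta> * V2 + 2 * d * q2"]
    by linarith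
  have "0 < (y\<^sup>2 * (b / 18 * u - 3 * max 0 (u - v)) + (1 - y\<^sup>2) * ((3 - s) / 2 * v - 1) - 4 * d\<^sup>2) * n"
    using pos n by (rule mult_pos_pos)
  also have "\<dots> = y\<^sup>2 * ((b / 18 * u - 3 * max 0 (u - v)) * n)
      + (1 - y\<^sup>2) * (((3 - s) / 2 * v - 1) * n) + - 4 * d\<^sup>2 * n"
    by (simp add: algebra_simps)
  finally show ?thesis using 1 2 3 by linarith
qed

text \<open>There are two regimes. For r < h/4, both the Riccati term and h v - 1 are at least b/48
  times 1/r, so any convex combination beats the cutoff cost 8 k^2 / r. For larger r the cutoff is
  so close to 1 that the Riccati term alone dominates. The choice of \<open>k\<close> serves
  both.\<close>

lemma coefficient_pos:
  fixes b h k r v :: real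
  assumes b: "0 < b" "b \<le> 9" and h: "b / 12 \<le> h" "h \<le> 3 / 2"
  defines "k \<equiv> b\<^sup>2 / 10000"
  assumes r: "2 * exp (- 1 / k) < r" "r \<le> 2"
    and e: "0 \<le> e" "e < 1" "1 - e < 2 * exp (- 1 / k) * b / 108"
    and T: "T\<^sup>2 \<le> 2 * (1 / r)"
  defines "\<theta> \<equiv> k * ln (2 / r)" and "v \<equiv> 1 / (1 + e * (r - 1))"
  defines "y \<equiv> 1 - \<theta>\<^sup>2"
  shows "v > 0" and "\<theta>\<^sup>2 \<le> 1"
    and "y\<^sup>2 * (b / 18 * (1 / r) - 3 * max 0 (1 / r - v)) + (1 - y\<^sup>2) * (h * v - 1) - 4 * (k * T)\<^sup>2 > 0"
proof -
  define a where "a = 2 * exp (- 1 / k)"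
  define \<rho> where "\<rho> = 1 + e * (r - 1)"
  have k: "k > 0" using b by (simp add: k_def)
  have a: "a > 0" by (simp add: a_def)
  have ra: "a < r" and ea: "1 - e < a * b / 108" using r e by (simp_all add: a_def)
  have r0: "r > 0" using a ra by linarith
  have \<rho>_eq: "\<rho> = r + (1 - e) * (1 - r)" by (simp add: \<rho>_def algebra_simps)
  have "\<rho> = (1 - e) + e * r" by (simp add: \<rho>_def algebra_simps)
  then have \<rho>: "\<rho> > 0" using e r0 by (smt (verit) mult_nonneg_nonneg)
  then show v: "v > 0" by (simp add: v_def \<rho>_def)
  have "ln (2 / a) = 1 / k" by (simp add: a_def ln_div)
  moreover have "ln (2 / r) \<le> ln (2 / a)"
    using ra a r0 by (subst ln_le_cancel_iff) (auto simp: field_simps)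
  ultimately have "k * ln (2 / r) \<le> k * (1 / k)"
    using k by (intro mult_left_mono) auto
  then have \<theta>1: "\<theta> \<le> 1"
    using k by (simp add: \<theta>_def)
  have "ln (2 / r) \<ge> 0" using r r0 by simp
  then have \<theta>0: "0 \<le> \<theta>" using k by (simp add: \<theta>_def)
  show \<theta>2: "\<theta>\<^sup>2 \<le> 1" using \<theta>0 \<theta>1 by (simp add: power_le_one)
  have y: "0 \<le> y" "y \<le> 1" using \<theta>2 by (auto simp: y_def)
  have y2: "y\<^sup>2 \<le> 1" using y by (simp add: power_le_one)
  have ab: "a * b / 108 \<le> a"
    using a b by (simp add: field_simps)
  \<comment> \<open>The constant 108 makes three times this error b/36 times 1/r, half of the
    available b/18 times 1/r.\<close>
  have v_lower: "1 / r - v \<le> b / 108 * (1 / r)"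
  proof (cases "r \<ge> 1")
    case True
    then have "\<rho> \<le> r" using e by (simp add: \<rho>_eq mult_nonneg_nonpos)
    then have "1 / r \<le> v" using \<rho> by (simp add: v_def \<rho>_def[symmetric] frac_le)
    moreover have "0 \<le> b / 108 * (1 / r)" using b r0 by simp
    ultimately show ?thesis by linarith
  next
    case False
    then have *: "r \<le> \<rho>" using e by (simp add: \<rho>_eq)
    have "a * (b / 108) \<le> \<rho> * (b / 108)" using ra * b by (intro mult_right_mono) auto
    then have a\<rho>: "1 - e \<le> \<rho> * (b / 108)" using ea by simp
    have "(1 - e) * (1 - r) \<le> (1 - e) * 1" using e r0 by (intro mult_left_mono) auto
    also have "\<dots> \<le> \<rho> * (b / 108)"
      using a\<rho> by simp
    finally have "\<rho> - r \<le> \<rho> * (b / 108)" by (simp add: \<rho>_eq)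
    then have "(\<rho> - r) / (\<rho> * r) \<le> \<rho> * (b / 108) / (\<rho> * r)"
      using \<rho> r0 by (intro divide_right_mono) auto
    then show ?thesis using \<rho> r0 by (simp add: v_def \<rho>_def[symmetric] diff_divide_distrib)
  qed
  have "0 \<le> b / 108 * (1 / r)" using b r0 by simp
  with v_lower have "b / 36 * (1 / r) \<le> b / 18 * (1 / r) - 3 * max 0 (1 / r - v)"
    by (simp add: max_def)
  then have first: "y\<^sup>2 * (b / 36 * (1 / r)) \<le> y\<^sup>2 * (b / 18 * (1 / r) - 3 * max 0 (1 / r - v))"
    by (intro mult_left_mono) auto
  have "(k * T)\<^sup>2 \<le> k\<^sup>2 * (2 * (1 / r))"
    unfolding power_mult_distrib using T by (intro mult_left_mono) auto
  then have third: "4 * (k * T)\<^sup>2 \<le> 8 * k\<^sup>2 * (1 / r)" by simp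
  have b4: "b ^ 4 \<le> 729 * b"
    using mult_right_mono[OF power_mono[of b 9 3], of b] b by (simp add: power_Suc2[symmetric] eval_nat_numeral)
  then have k2: "8 * k\<^sup>2 \<le> b / 10000"
    using b by (simp add: k_def power_divide)
  show "y\<^sup>2 * (b / 18 * (1 / r) - 3 * max 0 (1 / r - v)) + (1 - y\<^sup>2) * (h * v - 1) - 4 * (k * T)\<^sup>2 > 0"
  proof (cases "r < h / 4")
    case True
    then have "1 - r \<le> 1" "r < 1" using r0 h by linarith+
    then have "(1 - e) * (1 - r) \<le> 1 - e" using e by (simp add: mult_left_le)
    then have "\<rho> \<le> 2 * r" using ab ea ra \<rho>_eq by linarith
    then have "1 / (2 * r) \<le> v"
      using \<rho> by (simp only: v_def \<rho>_def[symmetric] frac_le)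
    then have "h * (1 / (2 * r)) \<le> h * v"
      using h b by (intro mult_left_mono) auto
    moreover have "1 \<le> h * (1 / (4 * r))"
      using True r0 by (simp add: field_simps)
    ultimately have "h / 4 * (1 / r) \<le> h * v - 1" by simp
    moreover have "b / 48 * (1 / r) \<le> h / 4 * (1 / r)"
      using h r0 by (intro mult_right_mono) auto
    ultimately have "(1 - y\<^sup>2) * (b / 48 * (1 / r)) \<le> (1 - y\<^sup>2) * (h * v - 1)"
      using y2 by (intro mult_left_mono) auto
    moreover have "y\<^sup>2 * (b / 48 * (1 / r)) \<le> y\<^sup>2 * (b / 36 * (1 / r))"
      using b r0 by (intro mult_left_mono mult_right_mono) auto
    moreover have "(1 - y\<^sup>2) * (b / 48 * (1 / r)) + y\<^sup>2 * (b / 48 * (1 / r)) = b / 48 * (1 / r)"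
      by (simp only: distrib_right[symmetric]) simp
    moreover have "8 * k\<^sup>2 * (1 / r) < b / 48 * (1 / r)"
      using k2 b r0 by (intro mult_strict_right_mono) auto
    ultimately show ?thesis using first third by linarith
  next
    case False
    \<comment> \<open>Here r >= h/4 >= b/48 bounds the logarithm by 96/b; the square in k = b^2 /
      10000 then leaves \<theta> of order b.\<close>
    have "ln (2 / r) \<le> 2 / r - 1" using r0 by (intro ln_le_minus_one) auto
    also have "\<dots> \<le> 2 / r" by simp
    also have "\<dots> \<le> 96 / b"
      using False h b r0 by (simp add: field_simps)
    finally have "\<theta> \<le> k * (96 / b)" unfolding \<theta>_def using k by (intro mult_left_mono) auto
    then have "\<theta> \<le> 96 * b / 10000" using b by (simp add: k_def power2_eq_square)
    then have "\<theta>\<^sup>2 \<le> (96 * b / 10000)\<^sup>2" using \<theta>0 by (intro power_mono)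
    also have "\<dots> \<le> b / 1000"
      using b by (simp add: power_divide power_mult_distrib power2_eq_square)
    finally have small: "\<theta>\<^sup>2 \<le> b / 1000" .
    have "1 - y\<^sup>2 = \<theta>\<^sup>2 * (1 + y)" by (simp add: y_def power2_eq_square algebra_simps)
    also have "\<dots> \<le> \<theta>\<^sup>2 * 2" using y by (intro mult_left_mono) auto
    finally have 1: "1 - y\<^sup>2 \<le> b / 500" using small by linarith
    have "- 1 \<le> h * v - 1" using h b v by simp
    then have "(1 - y\<^sup>2) * (- 1) \<le> (1 - y\<^sup>2) * (h * v - 1)"
      using y2 by (intro mult_left_mono) auto
    then have "- (1 - y\<^sup>2) \<le> (1 - y\<^sup>2) * (h * v - 1)"
      unfolding mult_minus1_right .
    moreover have "b / 500 \<le> b / 250 * (1 / r)"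
      using b r r0 by (simp add: field_simps)
    ultimately have second: "- (b / 250 * (1 / r)) \<le> (1 - y\<^sup>2) * (h * v - 1)"
      using 1 by linarith
    have "1 / 2 \<le> y\<^sup>2" using 1 b by linarith
    then have "1 / 2 * (b / 36 * (1 / r)) \<le> y\<^sup>2 * (b / 36 * (1 / r))"
      using b r0 by (intro mult_right_mono) auto
    moreover have "8 * k\<^sup>2 * (1 / r) \<le> b / 10000 * (1 / r)"
      using k2 r0 by (intro mult_right_mono) auto
    moreover have "b * (1 / r) > 0" using b r0 by simp
    ultimately show ?thesis using first second third by linarith
  qed
qed

section \<open>Choice of constants and assembly\<close>

theorem theorem1p7:
  fixes \<beta> :: real
  assumes "0 < \<beta>" and "\<beta> \<le> 9"
  shows "\<exists>\<delta>>0. \<forall>e\<in>{-1<..<1}. 1 - \<bar>e\<bar> < \<delta> \<longrightarrow>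
           (\<forall>\<gamma>. is_gamma \<beta> e \<gamma> \<longrightarrow> hyperbolic (\<gamma> (2 * pi)))"
proof -
  define k s where "k = \<beta>\<^sup>2 / 10000" and "s = sqrt (9 - \<beta>)"
  define a h where "a = 2 * exp (- 1 / k)" and "h = (3 - s) / 2"
  have k: "k > 0" using assms by (simp add: k_def)
  have a: "a > 0" by (simp add: a_def)
  have s2: "s\<^sup>2 = 9 - \<beta>" and s0: "0 \<le> s" using assms by (simp_all add: s_def)
  have s3: "s < 3" unfolding s_def using assms by (intro real_less_lsqrt) auto
  have "\<beta> = (3 - s) * (3 + s)" using s2 by (simp add: power2_eq_square algebra_simps)
  also have "\<dots> \<le> (3 - s) * 6" using s3 by (intro mult_left_mono) auto
  finally have h: "\<beta> / 12 \<le> h" "h \<le> 3 / 2" using s0 by (auto simp: h_def)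
  \<comment> \<open>The threshold \<open>a\<close> must lie well below \<open>h\<close>, so that the
    lower right block of \<open>B\<close> is negative definite wherever the cutoff vanishes.\<close>
  have "1 + 1 / k \<le> exp (1 / k)" by (rule exp_ge_add_one_self)
  then have "1 / k < exp (1 / k)" by linarith
  then have "exp (- 1 / k) < k"
    using k by (simp add: exp_minus field_simps)
  moreover have "k \<le> \<beta> * 9 / 10000"
    using assms by (simp add: k_def power2_eq_square)
  ultimately have a_h: "2 * a < h" using h assms by (simp add: a_def)
  have "hyperbolic (\<gamma> (2 * pi))"
    if e: "-1 < e" "e < 1" "1 - \<bar>e\<bar> < a * \<beta> / 108" and \<gamma>: "is_gamma \<beta> e \<gamma>" for e \<gamma>
  proof -
    \<comment> \<open>For \<open>e < 0\<close> the near-singularity sits at \<open>t = 0\<close>; the sign moves it back to \<open>cos = -1\<close>.\<close>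
    define \<sigma> :: real where "\<sigma> = (if e \<ge> 0 then 1 else -1)"
    define C S where "C = (\<lambda>t. \<sigma> * cos t)" and "S = (\<lambda>t. \<sigma> * sin t)"
    have \<sigma>: "\<sigma>\<^sup>2 = 1" and ec: "e * cos t = \<bar>e\<bar> * C t" for t
      by (auto simp: \<sigma>_def C_def)
    have CS: "(C t)\<^sup>2 + (S t)\<^sup>2 = 1" for t
      by (simp add: C_def S_def power_mult_distrib \<sigma>)
    have C1: "C t \<le> 1" "-1 \<le> C t" for t
      by (auto simp: C_def \<sigma>_def minus_le_iff)
    have dC: "(C has_real_derivative - S t) (at t)" and dS: "(S has_real_derivative C t) (at t)" for t
      unfolding C_def S_def by (auto intro!: derivative_eq_intros)
    \<comment> \<open>\<open>f\<close> is the cutoff x along the orbit and \<open>w\<close> is x T,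
      written with the quotient \<open>log_cutoff k r / r\<close> to stay differentiable at the pole
      of T.\<close>
    define f w where "f = (\<lambda>t. log_cutoff k (1 + C t))" and "w = (\<lambda>t. S t * (log_cutoff k (1 + C t) / (1 + C t)))"
    define f' where "f' = (\<lambda>t. log_cutoff' k (1 + C t) * - S t)"
    define w' where "w' = (\<lambda>t. C t * (log_cutoff k (1 + C t) / (1 + C t)) +
      (log_cutoff' k (1 + C t) * (1 + C t) - log_cutoff k (1 + C t)) / (1 + C t)\<^sup>2 * - S t * S t)"
    have d1C: "((\<lambda>t. 1 + C t) has_real_derivative - S t) (at t)" for t
      by (auto intro!: derivative_eq_intros dC)
    have df: "(f has_real_derivative f' t) (at t)" for t
      unfolding f_def f'_def by (rule DERIV_chain2[OF log_cutoff_has_derivative[OF k] d1C])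
    have dw: "(w has_real_derivative w' t) (at t)" for t
      unfolding w_def w'_def
      by (rule DERIV_mult[OF dS DERIV_chain2[OF log_cutoff_divide_has_derivative[OF k] d1C]])
    have den: "1 + e * cos t > 0" for t
    proof -
      have "\<bar>e * cos t\<bar> \<le> \<bar>e\<bar> * 1" unfolding abs_mult by (intro mult_left_mono) auto
      then show ?thesis using e by linarith
    qed
    define v where "v = (\<lambda>t. 1 / (1 + e * cos t))"
    have v: "v t > 0" for t using den by (simp add: v_def)
    have B33: "B \<beta> e t $ 3 $ 3 = 1 - (3 + s) / 2 * v t" for t
      using den[of t] by (simp add: B_def v_def s_def field_simps)
    have B44: "B \<beta> e t $ 4 $ 4 = 1 - (3 - s) / 2 * v t" for t
      using den[of t] by (simp add: B_def v_def s_def field_simps)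
    show ?thesis
    proof (rule hyperbolic_if_riccati[OF \<gamma>, where
        ?w11.0 = "\<lambda>t. - (1 + s / 6) * w t" and ?w11' = "\<lambda>t. - (1 + s / 6) * w' t" and
        ?w12.0 = "\<lambda>t. - (s / 6) * f t" and ?w12' = "\<lambda>t. - (s / 6) * f' t" and
        ?w22.0 = "\<lambda>t. - (1 - s / 6) * w t" and ?w22' = "\<lambda>t. - (1 - s / 6) * w' t"])
      fix t q1 q2 :: real
      assume q: "q1 \<noteq> 0 \<or> q2 \<noteq> 0"
      show "0 < - (- (1 + s / 6) * w' t + (- (1 + s / 6) * w t)\<^sup>2 + (- (s / 6) * f t)\<^sup>2
              + B \<beta> e t $ 3 $ 3 - 2 * (- (s / 6) * f t)) * q1\<^sup>2
          - 2 * (- (s / 6) * f' t + - (s / 6) * f t * (- (1 + s / 6) * w t + - (1 - s / 6) * w t)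
              + - (1 + s / 6) * w t - - (1 - s / 6) * w t) * q1 * q2
          - (- (1 - s / 6) * w' t + (- (s / 6) * f t)\<^sup>2 + (- (1 - s / 6) * w t)\<^sup>2
              + B \<beta> e t $ 4 $ 4 + 2 * (- (s / 6) * f t)) * q2\<^sup>2"
      proof (cases "1 + C t \<le> a")
        \<comment> \<open>W vanishes here, and the form reduces to the negated lower right block of
          \<open>B\<close>, which is positive because 1 + e cos t < h.\<close>
        case True
        then have 0: "f t = 0" "w t = 0" "f' t = 0" "w' t = 0"
          by (simp_all add: f_def w_def f'_def w'_def log_cutoff_def log_cutoff'_def a_def)
        have "\<bar>e\<bar> * C t = C t + (1 - \<bar>e\<bar>) * - C t" by (simp add: algebra_simps)
        also have "\<dots> \<le> C t + (1 - \<bar>e\<bar>) * 1"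
          using e C1[of t] by (intro add_left_mono mult_left_mono) auto
        finally have "e * cos t \<le> C t + (1 - \<bar>e\<bar>)" by (simp only: ec mult_1_right)
        then have "1 + e * cos t \<le> a + a * \<beta> / 108" using True e by linarith
        also have "\<dots> < h" using a_h a assms by (smt (verit) divide_le_eq mult_left_mono)
        finally have hv: "1 < h * v t" using den[of t] by (simp add: v_def)
        have "(3 - s) / 2 * v t \<le> (3 + s) / 2 * v t"
          using s0 v[of t] by (intro mult_right_mono) auto
        with hv have "0 < (3 + s) / 2 * v t - 1" "0 < (3 - s) / 2 * v t - 1"
          by (simp_all add: h_def)
        then have "0 < ((3 + s) / 2 * v t - 1) * q1\<^sup>2 + ((3 - s) / 2 * v t - 1) * q2\<^sup>2"
          using q by (smt (verit) mult_pos_pos mult_nonneg_nonneg zero_le_power2 zero_less_power2)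
        then show ?thesis by (simp add: 0 B33 B44 algebra_simps)
      next
        case False
        define r T \<theta> y where "r = 1 + C t" and "T = S t / r" and "\<theta> = k * ln (2 / r)" and "y = 1 - \<theta>\<^sup>2"
        have r: "a < r" "r \<le> 2" "r > 0" using False C1[of t] a by (auto simp: r_def)
        have C: "C t = r - 1" and S: "S t = r * T" using r by (auto simp: r_def T_def)
        \<comment> \<open>\<open>T\<close> is the tangent of half the angle, shifted by \<pi> if e <
          0; this is the half-angle identity.\<close>
        have "r * (r * (1 + T\<^sup>2)) = r * 2"
          using CS[of t] unfolding C S by (simp add: power2_eq_square algebra_simps)
        then have rT: "r * (1 + T\<^sup>2) = 2" using r by simp
        then have u: "2 * (1 / r) = 1 + T\<^sup>2" using r by (simp add: field_simps)
        have f: "f t = y\<^sup>2" using r by (simp add: f_def log_cutoff_def a_def y_def \<theta>_def r_def)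
        have f': "f' t = - 4 * y * \<theta> * (k * T)"
          using r by (simp add: f'_def log_cutoff'_def a_def y_def \<theta>_def T_def algebra_simps diff_divide_distrib flip: r_def)
        have w: "w t = y\<^sup>2 * T" using f by (simp add: w_def f_def T_def flip: r_def)
        have lc: "log_cutoff k r = y\<^sup>2" "f' t = - (log_cutoff' k r * (r * T))"
          using f S by (simp_all add: f_def f'_def flip: r_def)
        \<comment> \<open>The target is the product rule for x T, with 1/r as the derivative of
          T.\<close>
        have "w' t = ((r - 1) * r * log_cutoff k r - (r * T)\<^sup>2 * (log_cutoff' k r * r - log_cutoff k r)) / r\<^sup>2"
          using r by (simp add: w'_def C S power2_eq_square field_simps flip: r_def)
        also have "\<dots> = f' t * T + y\<^sup>2 * ((r - 1) / r + T\<^sup>2)"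
          using r lc by (simp add: field_simps power2_eq_square)
        also have "(r - 1) / r + T\<^sup>2 = 1 / r" using u r by (simp add: diff_divide_distrib)
        finally have w': "w' t = f' t * T + y\<^sup>2 * (1 / r)" .
        have v_eq: "v t = 1 / (1 + \<bar>e\<bar> * (r - 1))" by (simp add: v_def ec C)
        have T2: "T\<^sup>2 \<le> 2 * (1 / r)" using u by simp
        note pos = coefficient_pos[OF assms h, of r "\<bar>e\<bar>" T, folded k_def, OF r(1)[unfolded a_def] r(2) _ _ e(3)[unfolded a_def] T2,
            folded \<theta>_def v_eq, folded y_def]
        note identity = riccati_identity[OF s2 u, where x = "y\<^sup>2" and dx = "f' t" and v = "v t" and ?q1.0 = q1 and ?q2.0 = q2]
        show ?thesis
          unfolding w w' f B33 B44 identity unfolding f'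
          by (rule cutoff_form_pos[OF s0 s3 v _ q, where b = \<beta> and \<theta> = \<theta>, folded y_def])
             (use pos e in \<open>auto simp: h_def\<close>)
      qed
    qed (rule DERIV_cmult[OF dw] DERIV_cmult[OF df] | simp add: w_def f_def C_def S_def)+
  qed
  then show ?thesis
    using a assms by (intro exI[of _ "a * \<beta> / 108"]) auto
qed

end
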